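(* Let $(X,\tau)$ be a zero-dimensional Hausdorff space. Then the ordered sets $(\mathcal{L}_0(X),\le)$ and $(\mathcal{LP}_0(X,\tau),\preceq)$ are isomorphic.
   Context: A space is zero-dimensional if it has a base of clopen sets. Extensions. An extension of $X$ is a pair $(Y,f)$ where $f:X\to Y$ is a homeomorphic embedding with dense image. Two extensions $(Y_1,f_1),(Y_2,f_2)$ are equivalent if there is a homeomorphism $h:Y_1\to Y_2$ with $h\circ f_1=f_2$. $\mathcal{L}_0(X)$ is the set of all equivalence classes of zero-dimensional locally compact Hausdorff extensions of $X$, ordered by: $[(Y_1,f_1)]\le[(Y_2,f_2)]$ iff there is a continuous map $h:Y_2\to Y_1$ with $f_1=h\circ f_2$. Local proximities. A local proximity space is a triple $(X,\delta,\mathcal{B})$ where $X$ is a set, $\mathcal{B}$ is an ideal (possibly non-proper) of the power set $P(X)$, and $\delta$ is a symmetric binary relation on $P(X)$ such that (writing $D\ll E$ iff not $D\,\delta\,(X\setminus E)$): (P1) not $\emptyset\,\delta\,A$ for every $A\subseteq X$; (P2) $A\,\delta\,A$ for every $A\ne\emptyset$; (P3) $A\,\delta\,(B\cup C)$ iff $A\,\delta\,B$ or $A\,\delta\,C$; (BC1) if $A\in\mathcal{B}$, $C\subseteq X$ and $A\ll C$, then there is $B\in\mathcal{B}$ with $A\ll B\ll C$; (BC2) if $A\,\delta\,C$, then there is $B\in\mathcal{B}$ with $B\subseteq C$ and $A\,\delta\,B$. It is separated if $\{x\}\,\delta\,\{y\}$ iff $x=y$. A separated local proximity space induces a Tychonoff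 topology on $X$ by $\mathrm{cl}(M)=\{x\in X : \{x\}\,\delta\,M\}$; it is a local proximity space on $(X,\tau)$ if this topology is $\tau$. $(X,\delta,\mathcal{B})$ is zero-dimensional if for all $A,B\in\mathcal{B}$ with $A\ll B$ there is $C\subseteq X$ with $A\subseteq C\subseteq B$ and $C\ll C$. $\mathcal{LP}_0(X,\tau)$ is the set of all separated zero-dimensional local proximity spaces on $(X,\tau)$, ordered by: $(X,\beta_1,\mathcal{B}_1)\preceq(X,\beta_2,\mathcal{B}_2)$ iff $\beta_2\subseteq\beta_1$ and $\mathcal{B}_2\subseteq\mathcal{B}_1$. *)

theory Defs
  imports "HOL-Analysis.Analysis"
begin

section \<open>Zero-dimensional locally compact Hausdorff extensions\<close>

definition zero_dimensional_space :: "'a topology \<Rightarrow> bool" where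
  "zero_dimensional_space X \<longleftrightarrow>
     (\<exists>\<C>. (\<forall>S\<in>\<C>. openin X S \<and> closedin X S) \<and> openin X = arbitrary union_of (\<lambda>S. S \<in> \<C>))"

definition extension :: "'a topology \<Rightarrow> 'b topology \<times> ('a \<Rightarrow> 'b) \<Rightarrow> bool" where
  "extension X = (\<lambda>(Y, f). embedding_map X Y f \<and> Y closure_of (f ` topspace X) = topspace Y)"

text \<open>The relations between extensions only look at the embeddings on the points of \<open>X\<close>;
  values of the (total) embedding functions outside \<open>topspace X\<close> are irrelevant.\<close>

definition ext_equiv ::
    "'a topology \<Rightarrow> 'b topology \<times> ('a \<Rightarrow> 'b) \<Rightarrow> 'c topology \<times> ('a \<Rightarrow> 'c) \<Rightarrow> bool" where
  "ext_equiv X = (\<lambda>(Y1, f1) (Y2, f2).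
     \<exists>h. homeomorphic_map Y1 Y2 h \<and> (\<forall>x\<in>topspace X. h (f1 x) = f2 x))"

definition ext_le ::
    "'a topology \<Rightarrow> 'b topology \<times> ('a \<Rightarrow> 'b) \<Rightarrow> 'c topology \<times> ('a \<Rightarrow> 'c) \<Rightarrow> bool" where
  "ext_le X = (\<lambda>(Y1, f1) (Y2, f2).
     \<exists>h. continuous_map Y2 Y1 h \<and> (\<forall>x\<in>topspace X. f1 x = h (f2 x)))"

definition zlc_extension :: "'a topology \<Rightarrow> 'b topology \<times> ('a \<Rightarrow> 'b) \<Rightarrow> bool" where
  "zlc_extension X E \<longleftrightarrow> extension X E \<and> zero_dimensional_space (fst E) \<and>
     locally_compact_space (fst E) \<and> Hausdorff_space (fst E)"

text \<open>HOL cannot collect the extensions of \<open>X\<close> over all point types at once.  A point of a Hausdorff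
  extension is determined by the traces on \<open>X\<close> of its open neighbourhoods, so the point type
  \<open>'a set set\<close> suffices: every extension, over any type, is equivalent to one over \<open>'a set set\<close>
  (lemma \<open>zlc_extension_small\<close> below).\<close>

type_synonym 'a ext = "'a set set topology \<times> ('a \<Rightarrow> 'a set set)"

definition ext_rel :: "'a topology \<Rightarrow> 'a ext rel" where
  "ext_rel X = {(E1, E2). zlc_extension X E1 \<and> zlc_extension X E2 \<and> ext_equiv X E1 E2}"

definition L0 :: "'a topology \<Rightarrow> 'a ext set set" where
  "L0 X = {E. zlc_extension X E} // ext_rel X"

text \<open>The order does not depend on the representatives (lemma \<open>L0_le_class\<close> below).\<close>

definition L0_le :: "'a topology \<Rightarrow> 'a ext set \<Rightarrow> 'a ext set \<Rightarrow> bool" where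
  "L0_le X c1 c2 \<longleftrightarrow> (\<exists>E1\<in>c1. \<exists>E2\<in>c2. ext_le X E1 E2)"


section \<open>Local proximities\<close>

definition ideal_on :: "'a set \<Rightarrow> 'a set set \<Rightarrow> bool" where
  "ideal_on X \<B> \<longleftrightarrow> \<B> \<subseteq> Pow X \<and> {} \<in> \<B> \<and>
     (\<forall>A B. A \<in> \<B> \<and> B \<subseteq> A \<longrightarrow> B \<in> \<B>) \<and> (\<forall>A\<in>\<B>. \<forall>B\<in>\<B>. A \<union> B \<in> \<B>)"

definition strongly_below :: "'a set \<Rightarrow> 'a set rel \<Rightarrow> 'a set \<Rightarrow> 'a set \<Rightarrow> bool" where
  "strongly_below X \<delta> D E \<longleftrightarrow> (D, X - E) \<notin> \<delta>"

definition local_proximity :: "'a set \<Rightarrow> 'a set rel \<Rightarrow> 'a set set \<Rightarrow> bool" where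
  "local_proximity X \<delta> \<B> \<longleftrightarrow>
     ideal_on X \<B> \<and> \<delta> \<subseteq> Pow X \<times> Pow X \<and> sym \<delta> \<and>
     (\<forall>A\<subseteq>X. ({}, A) \<notin> \<delta>) \<and>
     (\<forall>A\<subseteq>X. A \<noteq> {} \<longrightarrow> (A, A) \<in> \<delta>) \<and>
     (\<forall>A\<subseteq>X. \<forall>B\<subseteq>X. \<forall>C\<subseteq>X. (A, B \<union> C) \<in> \<delta> \<longleftrightarrow> (A, B) \<in> \<delta> \<or> (A, C) \<in> \<delta>) \<and>
     (\<forall>A\<in>\<B>. \<forall>C\<subseteq>X. strongly_below X \<delta> A C \<longrightarrow>
        (\<exists>B\<in>\<B>. strongly_below X \<delta> A B \<and> strongly_below X \<delta> B C)) \<and>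
     (\<forall>A\<subseteq>X. \<forall>C\<subseteq>X. (A, C) \<in> \<delta> \<longrightarrow> (\<exists>B\<in>\<B>. B \<subseteq> C \<and> (A, B) \<in> \<delta>))"

definition separated_proximity :: "'a set \<Rightarrow> 'a set rel \<Rightarrow> bool" where
  "separated_proximity X \<delta> \<longleftrightarrow> (\<forall>x\<in>X. \<forall>y\<in>X. ({x}, {y}) \<in> \<delta> \<longleftrightarrow> x = y)"

text \<open>A topology is determined by its closure operator, so the following says that \<open>T\<close> is the
  topology on \<open>topspace T\<close> induced by \<open>\<delta>\<close>.\<close>

definition induces_topology :: "'a set rel \<Rightarrow> 'a topology \<Rightarrow> bool" where
  "induces_topology \<delta> T \<longleftrightarrow>
     (\<forall>M\<subseteq>topspace T. T closure_of M = {x \<in> topspace T. ({x}, M) \<in> \<delta>})"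

definition zero_dimensional_proximity :: "'a set \<Rightarrow> 'a set rel \<Rightarrow> 'a set set \<Rightarrow> bool" where
  "zero_dimensional_proximity X \<delta> \<B> \<longleftrightarrow>
     (\<forall>A\<in>\<B>. \<forall>B\<in>\<B>. strongly_below X \<delta> A B \<longrightarrow>
        (\<exists>C\<subseteq>X. A \<subseteq> C \<and> C \<subseteq> B \<and> strongly_below X \<delta> C C))"

text \<open>The first component of the triple \<open>(X, \<delta>, \<B>)\<close> is the fixed set \<open>topspace T\<close> and is left out.\<close>

definition LP0 :: "'a topology \<Rightarrow> ('a set rel \<times> 'a set set) set" where
  "LP0 T = {(\<delta>, \<B>). local_proximity (topspace T) \<delta> \<B> \<and> separated_proximity (topspace T) \<delta> \<and>
     induces_topology \<delta> T \<and> zero_dimensional_proximity (topspace T) \<delta> \<B>}"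

definition LP0_le :: "'a set rel \<times> 'a set set \<Rightarrow> 'a set rel \<times> 'a set set \<Rightarrow> bool" where
  "LP0_le = (\<lambda>(\<delta>1, \<B>1) (\<delta>2, \<B>2). \<delta>2 \<subseteq> \<delta>1 \<and> \<B>2 \<subseteq> \<B>1)"


section \<open>Isomorphism of ordered sets\<close>

definition order_isomorphic ::
    "'a set \<Rightarrow> ('a \<Rightarrow> 'a \<Rightarrow> bool) \<Rightarrow> 'b set \<Rightarrow> ('b \<Rightarrow> 'b \<Rightarrow> bool) \<Rightarrow> bool" where
  "order_isomorphic A leA B leB \<longleftrightarrow>
     (\<exists>\<Phi>. bij_betw \<Phi> A B \<and> (\<forall>x\<in>A. \<forall>y\<in>A. leA x y \<longleftrightarrow> leB (\<Phi> x) (\<Phi> y)))"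


section \<open>The classes and their order are well defined\<close>

lemma ext_equiv_refl: "ext_equiv X E E"
  unfolding ext_equiv_def by (cases E) (auto intro!: exI[of _ id])

lemma ext_equiv_sym:
  assumes "extension X E1" "ext_equiv X E1 E2"
  shows "ext_equiv X E2 E1"
proof -
  obtain Y1 f1 Y2 f2 where E: "E1 = (Y1, f1)" "E2 = (Y2, f2)" by fastforce
  obtain h where h: "homeomorphic_map Y1 Y2 h" "\<forall>x\<in>topspace X. h (f1 x) = f2 x"
    using assms(2) by (auto simp: E ext_equiv_def)
  obtain k where k: "homeomorphic_maps Y1 Y2 h k"
    using h(1) homeomorphic_map_maps by blast
  have "f1 x \<in> topspace Y1" if "x \<in> topspace X" for x
    using assms(1) that
    by (auto simp: E extension_def embedding_map_def homeomorphic_eq_everything_map continuous_map_def)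
  then have "\<forall>x\<in>topspace X. k (f2 x) = f1 x"
    using h(2) k by (metis homeomorphic_maps_def)
  moreover have "homeomorphic_map Y2 Y1 k"
    using k by (meson homeomorphic_maps_map)
  ultimately show ?thesis by (auto simp: E ext_equiv_def)
qed

lemma ext_equiv_trans:
  assumes "ext_equiv X E1 E2" "ext_equiv X E2 E3"
  shows "ext_equiv X E1 E3"
proof -
  obtain Y1 f1 Y2 f2 Y3 f3 where E: "E1 = (Y1, f1)" "E2 = (Y2, f2)" "E3 = (Y3, f3)"
    by (metis surj_pair)
  obtain h k where "homeomorphic_map Y1 Y2 h" "\<forall>x\<in>topspace X. h (f1 x) = f2 x"
      "homeomorphic_map Y2 Y3 k" "\<forall>x\<in>topspace X. k (f2 x) = f3 x"
    using assms by (auto simp: E ext_equiv_def)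
  then show ?thesis
    by (auto simp: E ext_equiv_def intro!: exI[of _ "k \<circ> h"] intro: homeomorphic_map_compose)
qed

lemma equiv_ext_rel: "equiv {E. zlc_extension X E} (ext_rel X)"
proof (rule equivI)
  show "ext_rel X \<subseteq> {E. zlc_extension X E} \<times> {E. zlc_extension X E}"
    by (auto simp: ext_rel_def)
  show "refl_on {E. zlc_extension X E} (ext_rel X)"
    by (auto simp: refl_on_def ext_rel_def ext_equiv_refl)
  show "sym (ext_rel X)"
    by (rule symI) (auto simp: ext_rel_def zlc_extension_def intro: ext_equiv_sym)
  show "trans (ext_rel X)"
    by (rule transI) (auto simp: ext_rel_def intro: ext_equiv_trans)
qed

lemma ext_equiv_imp_le:
  assumes "ext_equiv X E1 E2" shows "ext_le X E2 E1"
  using assms unfolding ext_equiv_def ext_le_def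
  by (fastforce dest: homeomorphic_imp_continuous_map)

lemma ext_le_trans:
  assumes "ext_le X E1 E2" "ext_le X E2 E3"
  shows "ext_le X E1 E3"
proof -
  obtain Y1 f1 Y2 f2 Y3 f3 where E: "E1 = (Y1, f1)" "E2 = (Y2, f2)" "E3 = (Y3, f3)"
    by (metis surj_pair)
  obtain h k where "continuous_map Y2 Y1 h" "\<forall>x\<in>topspace X. f1 x = h (f2 x)"
      "continuous_map Y3 Y2 k" "\<forall>x\<in>topspace X. f2 x = k (f3 x)"
    using assms by (auto simp: E ext_le_def)
  then show ?thesis
    by (auto simp: E ext_le_def intro!: exI[of _ "h \<circ> k"] intro: continuous_map_compose)
qed

lemma L0_le_class:
  assumes "zlc_extension X E1" "zlc_extension X E2"
  shows "L0_le X (ext_rel X `` {E1}) (ext_rel X `` {E2}) \<longleftrightarrow> ext_le X E1 E2"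
proof
  assume "L0_le X (ext_rel X `` {E1}) (ext_rel X `` {E2})"
  then obtain F1 F2 where F: "(E1, F1) \<in> ext_rel X" "(E2, F2) \<in> ext_rel X" "ext_le X F1 F2"
    by (auto simp: L0_le_def)
  have "ext_le X E1 F1"
    using F(1) ext_equiv_sym[of X E1 F1]
    by (auto simp: ext_rel_def zlc_extension_def intro: ext_equiv_imp_le)
  moreover have "ext_le X F2 E2"
    using F(2) by (auto simp: ext_rel_def intro: ext_equiv_imp_le)
  ultimately show "ext_le X E1 E2"
    using F(3) ext_le_trans by metis
next
  assume "ext_le X E1 E2"
  then show "L0_le X (ext_rel X `` {E1}) (ext_rel X `` {E2})"
    using equiv_class_self[OF equiv_ext_rel, of E1] equiv_class_self[OF equiv_ext_rel, of E2] assms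
    unfolding L0_le_def by blast
qed

text \<open>With \<open>L0_le_class\<close>, antisymmetry of the order on \<open>L0 X\<close>.\<close>

lemma ext_le_antisym:
  assumes "zlc_extension X E1" "zlc_extension X E2" "ext_le X E1 E2" "ext_le X E2 E1"
  shows "ext_equiv X E1 E2"
proof -
  obtain Y1 f1 Y2 f2 where E: "E1 = (Y1, f1)" "E2 = (Y2, f2)" by fastforce
  obtain h k where h: "continuous_map Y2 Y1 h" "\<And>x. x \<in> topspace X \<Longrightarrow> h (f2 x) = f1 x"
    using assms(3) unfolding E ext_le_def by fastforce
  obtain k where k: "continuous_map Y1 Y2 k" "\<And>x. x \<in> topspace X \<Longrightarrow> k (f1 x) = f2 x"
    using assms(4) unfolding E ext_le_def by fastforce
  have H: "Hausdorff_space Y1" "Hausdorff_space Y2"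
    and D: "Y1 closure_of (f1 ` topspace X) = topspace Y1"
      "Y2 closure_of (f2 ` topspace X) = topspace Y2"
    using assms by (auto simp: E zlc_extension_def extension_def)
  have "(h \<circ> k) y = id y" if "y \<in> topspace Y1" for y
    by (rule forall_in_closure_of_eq[of y Y1 "f1 ` topspace X" Y1])
      (use that H D h k continuous_map_compose[OF h(1) k(1)] continuous_map_compose[OF k(1) h(1)]
        in \<open>auto simp: comp_def id_def\<close>)
  moreover have "(k \<circ> h) y = id y" if "y \<in> topspace Y2" for y
    by (rule forall_in_closure_of_eq[of y Y2 "f2 ` topspace X" Y2])
      (use that H D h k continuous_map_compose[OF h(1) k(1)] continuous_map_compose[OF k(1) h(1)]
        in \<open>auto simp: comp_def id_def\<close>)
  ultimately have "homeomorphic_maps Y1 Y2 k h"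
    using h(1) k(1) by (auto simp: homeomorphic_maps_def)
  then have "homeomorphic_map Y1 Y2 k" by (rule homeomorphic_maps_imp_map)
  then show ?thesis
    using k(2) by (auto simp: E ext_equiv_def)
qed


section \<open>The point type \<open>'a set set\<close> is large enough\<close>

lemma zero_dimensional_space_iff:
  "zero_dimensional_space X \<longleftrightarrow>
     (\<forall>U x. openin X U \<and> x \<in> U \<longrightarrow> (\<exists>V. openin X V \<and> closedin X V \<and> x \<in> V \<and> V \<subseteq> U))"
  (is "_ \<longleftrightarrow> ?R")
proof
  assume "zero_dimensional_space X"
  then obtain \<C> where cl: "\<And>S. S \<in> \<C> \<Longrightarrow> openin X S \<and> closedin X S"
    and "openin X = arbitrary union_of (\<lambda>S. S \<in> \<C>)"
    unfolding zero_dimensional_space_def by blast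
  then have base: "\<forall>U x. openin X U \<and> x \<in> U \<longrightarrow> (\<exists>V. V \<in> \<C> \<and> x \<in> V \<and> V \<subseteq> U)"
    using openin_topology_base_unique[of X "\<lambda>S. S \<in> \<C>"] by simp
  show ?R
  proof (intro allI impI)
    fix U x assume "openin X U \<and> x \<in> U"
    then obtain V where "V \<in> \<C>" "x \<in> V" "V \<subseteq> U" using base by blast
    then show "\<exists>V. openin X V \<and> closedin X V \<and> x \<in> V \<and> V \<subseteq> U" using cl by blast
  qed
next
  assume R: ?R
  have "openin X = arbitrary union_of (\<lambda>S. S \<in> {S. openin X S \<and> closedin X S})"
    unfolding openin_topology_base_unique using R by simp
  then show "zero_dimensional_space X"
    unfolding zero_dimensional_space_def
    by (intro exI[of _ "{S. openin X S \<and> closedin X S}"]) simp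
qed

lemma homeomorphic_zero_dimensional_space:
  assumes h: "homeomorphic_map Y Z h" and Y: "zero_dimensional_space Y"
  shows "zero_dimensional_space Z"
  unfolding zero_dimensional_space_iff
proof (intro allI impI, elim conjE)
  fix U z assume U: "openin Z U" "z \<in> U"
  obtain k where k: "homeomorphic_maps Y Z h k"
    using h homeomorphic_map_maps by blast
  have sub: "U \<subseteq> topspace Z" using U openin_subset by blast
  have hk: "\<forall>z\<in>topspace Z. h (k z) = z" and kZ: "homeomorphic_map Z Y k"
    using k by (simp add: homeomorphic_maps_def, simp add: homeomorphic_maps_map)
  have "openin Y (k ` U)"
    using kZ U sub homeomorphic_map_openness by blast
  then obtain V where V: "openin Y V" "closedin Y V" "k z \<in> V" "V \<subseteq> k ` U"
    using Y U unfolding zero_dimensional_space_iff by blast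
  have "V \<subseteq> topspace Y" using V openin_subset by blast
  then have "openin Z (h ` V)" "closedin Z (h ` V)"
    using h V by (simp_all add: homeomorphic_map_openness homeomorphic_map_closedness)
  moreover have "z \<in> h ` V" using V(3) hk U sub by (metis image_eqI subsetD)
  moreover have "h ` V \<subseteq> U" using V(4) hk sub by fastforce
  ultimately show "\<exists>V. openin Z V \<and> closedin Z V \<and> z \<in> V \<and> V \<subseteq> U" by blast
qed

lemma homeomorphic_zlc_extension:
  assumes E: "zlc_extension X (Y, f)" and h: "homeomorphic_map Y Z h"
  shows "zlc_extension X (Z, h \<circ> f)"
proof -
  have f: "embedding_map X Y f" and D: "Y closure_of (f ` topspace X) = topspace Y"
    and P: "zero_dimensional_space Y" "locally_compact_space Y" "Hausdorff_space Y"
    using E by (auto simp: zlc_extension_def extension_def)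
  have YZ: "Y homeomorphic_space Z"
    using h homeomorphic_map_imp_homeomorphic_space by blast
  have fX: "f ` topspace X \<subseteq> topspace Y"
    using f by (auto simp: embedding_map_def homeomorphic_eq_everything_map continuous_map_def)
  have "embedding_map Y Z h"
    using h by (simp add: embedding_map_def homeomorphic_imp_surjective_map)
  then have "embedding_map X Z (h \<circ> f)"
    using f embedding_map_compose by blast
  moreover have "Z closure_of ((h \<circ> f) ` topspace X) = topspace Z"
    using homeomorphic_map_closure_of[OF h fX] D homeomorphic_imp_surjective_map[OF h]
    by (simp add: image_comp)
  moreover have "zero_dimensional_space Z"
    using homeomorphic_zero_dimensional_space h P by blast
  moreover have "locally_compact_space Z" "Hausdorff_space Z"
    using P YZ homeomorphic_locally_compact_space homeomorphic_Hausdorff_space by blast+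
  ultimately show ?thesis by (simp add: zlc_extension_def extension_def)
qed

lemma zlc_extension_small:
  fixes X :: "'a topology" and Y :: "'b topology"
  assumes E: "zlc_extension X (Y, f)"
  obtains E' :: "'a ext" where "zlc_extension X E'" "ext_equiv X (Y, f) E'"
proof -
  define h where "h y = {{x \<in> topspace X. f x \<in> U} |U. openin Y U \<and> y \<in> U}" for y
  have H: "Hausdorff_space Y" and D: "Y closure_of (f ` topspace X) = topspace Y"
    using E by (auto simp: zlc_extension_def extension_def)
  have inj: "inj_on h (topspace Y)"
  proof (rule inj_onI, rule ccontr)
    fix y z assume yz: "y \<in> topspace Y" "z \<in> topspace Y" "h y = h z" "y \<noteq> z"
    obtain U V where UV: "openin Y U" "openin Y V" "y \<in> U" "z \<in> V" "disjnt U V"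
      using H yz unfolding Hausdorff_space_def by metis
    have "{x \<in> topspace X. f x \<in> U} \<in> h z"
      using UV yz(3) by (auto simp: h_def)
    then obtain W where W: "openin Y W" "z \<in> W"
      "{x \<in> topspace X. f x \<in> U} = {x \<in> topspace X. f x \<in> W}"
      by (auto simp: h_def)
    have "openin Y (V \<inter> W)" "z \<in> V \<inter> W" using UV W by auto
    moreover have "z \<in> Y closure_of (f ` topspace X)" using D yz by simp
    ultimately obtain x where "x \<in> topspace X" "f x \<in> V \<inter> W"
      unfolding in_closure_of by (metis imageE)
    then show False using W(3) UV(5) by (auto simp: disjnt_iff)
  qed
  define k where "k = inv_into (topspace Y) h"
  define Z where "Z = pullback_topology (h ` topspace Y) k Y"
  have kh: "k (h y) = y" if "y \<in> topspace Y" for y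
    using inj that by (simp add: k_def)
  have "topspace Z = h ` topspace Y"
    using kh by (auto simp: Z_def topspace_pullback_topology)
  moreover have "continuous_map Z Y k"
    unfolding Z_def by (rule continuous_map_pullback[of Y Y id, simplified])
  moreover have "continuous_map Y Z h"
    unfolding Z_def
    by (rule continuous_map_pullback')
      (auto intro: continuous_map_eq[OF continuous_map_id] simp: kh)
  ultimately have "homeomorphic_maps Y Z h k"
    using kh by (auto simp: homeomorphic_maps_def)
  then have h: "homeomorphic_map Y Z h" by (rule homeomorphic_maps_imp_map)
  show thesis
  proof
    show "zlc_extension X (Z, h \<circ> f)" by (rule homeomorphic_zlc_extension[OF E h])
    show "ext_equiv X (Y, f) (Z, h \<circ> f)" using h by (auto simp: ext_equiv_def)
  qed
qed

end

theory Submission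
  imports Defs
begin

text \<open>To an extension \<open>(Y, f)\<close> we assign the local proximity in which \<open>A\<close> and \<open>C\<close> are near iff
  the closures of \<open>f ` A\<close> and \<open>f ` C\<close> meet, and \<open>A\<close> is bounded iff the closure of \<open>f ` A\<close> is
  compact.  This preserves and reflects the orders: a map \<open>Y2 \<rightarrow> Y1\<close> over \<open>X\<close> is recovered from the
  inclusions by taking cluster points in \<open>Y1\<close> of the traces of neighbourhood filters of \<open>Y2\<close>.  For
  surjectivity, the bounded sets strongly below themselves form a ring \<open>R\<close> of subsets of \<open>X\<close> that
  determines the local proximity; the extension is the closure of \<open>X\<close> in the Cantor cube over \<open>R\<close>,
  with the zero point removed.\<close>

subsection \<open>The local proximity of an extension\<close>

text \<open>The members of \<open>\<C>\<close> inside \<open>U\<close> cover \<open>K\<close>, and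
  the union of a finite subcover is again a member; \<open>{}\<close> accounts for the empty
  subcover. It serves twice: for the compact open sets of an extension, and later for the sets
  \<open>K C\<close> of the constructed one.\<close>

lemma compactin_base_between:
  assumes K: "compactin Y K" and U: "K \<subseteq> U"
    and fin: "{} \<in> \<C>" "\<And>C D. C \<in> \<C> \<Longrightarrow> D \<in> \<C> \<Longrightarrow> C \<union> D \<in> \<C>"
    and op: "\<And>C. C \<in> \<C> \<Longrightarrow> openin Y C"
    and base: "\<And>y. y \<in> K \<Longrightarrow> \<exists>C\<in>\<C>. y \<in> C \<and> C \<subseteq> U"
  obtains C where "C \<in> \<C>" "K \<subseteq> C" "C \<subseteq> U"
proof -
  let ?\<U> = "{C \<in> \<C>. C \<subseteq> U}"
  have "\<forall>V\<in>?\<U>. openin Y V" "K \<subseteq> \<Union>?\<U>" using op base by blast+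
  then obtain \<F> where \<F>: "finite \<F>" "\<F> \<subseteq> ?\<U>" "K \<subseteq> \<Union>\<F>"
    using K unfolding compactin_def by meson
  have "\<Union>\<F> \<in> \<C>"
    using \<F>(1,2) by (induction rule: finite_induct) (use fin in auto)
  then show thesis using \<F> that by blast
qed

definition ext_proximity ::
    "'a topology \<Rightarrow> 'b topology \<times> ('a \<Rightarrow> 'b) \<Rightarrow> 'a set rel \<times> 'a set set" where
  "ext_proximity X = (\<lambda>(Y, f).
     ({(A, C). A \<subseteq> topspace X \<and> C \<subseteq> topspace X \<and>
         Y closure_of (f ` A) \<inter> Y closure_of (f ` C) \<noteq> {}},
      {A. A \<subseteq> topspace X \<and> compactin Y (Y closure_of (f ` A))}))"

locale zlc_ext =
  fixes X :: "'a topology" and Y :: "'b topology" and f :: "'a \<Rightarrow> 'b"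
  assumes zlc: "zlc_extension X (Y, f)"
begin

definition cl :: "'a set \<Rightarrow> 'b set" where
  "cl A = Y closure_of (f ` A)"

definition trace :: "'b set \<Rightarrow> 'a set" where
  "trace U = {x \<in> topspace X. f x \<in> U}"

definition \<delta> :: "'a set rel" where
  "\<delta> = {(A, C). A \<subseteq> topspace X \<and> C \<subseteq> topspace X \<and> cl A \<inter> cl C \<noteq> {}}"

definition \<B> :: "'a set set" where
  "\<B> = {A. A \<subseteq> topspace X \<and> compactin Y (cl A)}"

lemma ext_proximity_eq: "ext_proximity X (Y, f) = (\<delta>, \<B>)"
  by (simp add: ext_proximity_def \<delta>_def \<B>_def cl_def)

lemma embedding: "embedding_map X Y f"
  and Hausdorff: "Hausdorff_space Y"
  and locally_compact: "locally_compact_space Y"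
  and zero_dimensional: "zero_dimensional_space Y"
  and cl_topspace: "cl (topspace X) = topspace Y"
  using zlc by (auto simp: zlc_extension_def extension_def cl_def)

lemma f_in_topspace: "x \<in> topspace X \<Longrightarrow> f x \<in> topspace Y"
  using embedding
  by (auto simp: embedding_map_def homeomorphic_eq_everything_map continuous_map_def)

lemma inj_f: "inj_on f (topspace X)"
  using embedding by (auto simp: embedding_map_def homeomorphic_eq_everything_map)

lemma trace_subset: "trace U \<subseteq> topspace X"
  by (auto simp: trace_def)

lemma cl_mono: "A \<subseteq> C \<Longrightarrow> cl A \<subseteq> cl C"
  by (simp add: cl_def closure_of_mono image_mono)

lemma cl_Un: "cl (A \<union> C) = cl A \<union> cl C"
  by (simp add: cl_def image_Un)

lemma cl_empty [simp]: "cl {} = {}"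
  by (simp add: cl_def)

lemma closedin_cl: "closedin Y (cl A)"
  by (simp add: cl_def)

lemma cl_subset_topspace: "cl A \<subseteq> topspace Y"
  by (simp add: cl_def closure_of_subset_topspace)

lemma f_in_cl: "x \<in> A \<Longrightarrow> A \<subseteq> topspace X \<Longrightarrow> f x \<in> cl A"
  unfolding cl_def using closure_of_subset[of "f ` A" Y] f_in_topspace by blast

lemma cl_trace_closed: "closedin Y U \<Longrightarrow> cl (trace U) \<subseteq> U"
  unfolding cl_def by (rule closure_of_minimal) (auto simp: trace_def)

lemma in_cl_trace_Int:
  assumes "y \<in> cl A" "A \<subseteq> topspace X" "openin Y U" "y \<in> U"
  shows "y \<in> cl (A \<inter> trace U)"
  unfolding cl_def in_closure_of
proof (intro conjI allI impI)
  show "y \<in> topspace Y" using assms(1) cl_subset_topspace by blast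
  fix T assume "y \<in> T \<and> openin Y T"
  then have "y \<in> T \<inter> U" "openin Y (T \<inter> U)" using assms by auto
  then obtain z where "z \<in> f ` A" "z \<in> T \<inter> U"
    using assms(1) unfolding cl_def in_closure_of by blast
  then show "\<exists>z. z \<in> f ` (A \<inter> trace U) \<and> z \<in> T"
    using assms(2) by (auto simp: trace_def)
qed

text \<open>This is density of the image of \<open>X\<close>, localised to \<open>U\<close>.
  Together with \<open>cl_trace_closed\<close> it lets clopen sets be recovered from their
  traces.\<close>

lemma open_subset_cl_trace: "openin Y U \<Longrightarrow> U \<subseteq> cl (trace U)"
  using in_cl_trace_Int[of _ "topspace X" U] cl_topspace openin_subset[of Y U]
  by (metis inf.absorb_iff2 order_refl subset_iff trace_subset)

lemma cl_trace_clopen: "openin Y U \<Longrightarrow> closedin Y U \<Longrightarrow> cl (trace U) = U"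
  using cl_trace_closed open_subset_cl_trace by blast

text \<open>Since \<open>f\<close> is a homeomorphism onto its image, it carries the closure in
  \<open>X\<close> to the closure in the image, which is the image intersected with
  \<open>cl M\<close>; injectivity pulls this back. It is what makes \<open>\<delta>\<close> induce
  the given topology.\<close>

lemma closure_of_eq_cl:
  assumes "M \<subseteq> topspace X"
  shows "X closure_of M = {x \<in> topspace X. f x \<in> cl M}"
proof -
  let ?Z = "subtopology Y (f ` topspace X)"
  have h: "homeomorphic_map X ?Z f" using embedding by (simp add: embedding_map_def)
  have "f ` (X closure_of M) = ?Z closure_of (f ` M)"
    using homeomorphic_map_closure_of[OF h assms] by simp
  also have "\<dots> = f ` topspace X \<inter> cl M"
    using assms by (simp add: closure_of_subtopology cl_def inf.absorb2 image_mono)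
  finally have *: "f ` (X closure_of M) = f ` topspace X \<inter> cl M" .
  have sub: "X closure_of M \<subseteq> topspace X" by (simp add: closure_of_subset_topspace)
  show ?thesis
  proof (intro equalityI subsetI)
    fix x assume "x \<in> X closure_of M"
    then show "x \<in> {x \<in> topspace X. f x \<in> cl M}" using * sub by blast
  next
    fix x assume "x \<in> {x \<in> topspace X. f x \<in> cl M}"
    then have x: "x \<in> topspace X" "f x \<in> f ` (X closure_of M)" using * by simp_all
    then show "x \<in> X closure_of M" using sub inj_on_image_mem_iff[OF inj_f x(1)] by blast
  qed
qed

text \<open>Local compactness gives a compact \<open>K\<close> around \<open>y\<close>,
  zero-dimensionality a clopen \<open>V\<close> inside it, and a closed subset of a compact set is
  compact.\<close>

lemma compact_open_base:
  assumes "openin Y U" "y \<in> U"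
  obtains V where "openin Y V" "compactin Y V" "y \<in> V" "V \<subseteq> U"
proof -
  obtain W K where W: "openin Y W" "compactin Y K" "y \<in> W" "W \<subseteq> K"
    using locally_compact assms openin_subset unfolding locally_compact_space_def
    by (metis subsetD)
  have "openin Y (U \<inter> W)" "y \<in> U \<inter> W" using W assms by auto
  then obtain V where V: "openin Y V" "closedin Y V" "y \<in> V" "V \<subseteq> U \<inter> W"
    using zero_dimensional unfolding zero_dimensional_space_iff by blast
  have "V \<subseteq> K" using V(4) W(4) by blast
  then have "compactin Y V" using closed_compactin W(2) V(2) by blast
  then show thesis using that V by blast
qed

lemma compact_open_between:
  assumes "compactin Y K" "openin Y U" "K \<subseteq> U"
  obtains V where "openin Y V" "compactin Y V" "closedin Y V" "K \<subseteq> V" "V \<subseteq> U"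
proof -
  have *: "\<exists>V\<in>{V. openin Y V \<and> compactin Y V}. y \<in> V \<and> V \<subseteq> U" if "y \<in> K" for y
  proof -
    have "y \<in> U" using that assms(3) by blast
    then obtain V where "openin Y V" "compactin Y V" "y \<in> V" "V \<subseteq> U"
      using compact_open_base assms(2) by metis
    then show ?thesis by blast
  qed
  obtain V where "V \<in> {V. openin Y V \<and> compactin Y V}" "K \<subseteq> V" "V \<subseteq> U"
    by (rule compactin_base_between[OF assms(1,3) _ _ _ *]) (auto intro: compactin_Un)
  then show thesis using that compactin_imp_closedin[OF Hausdorff] by blast
qed

lemma strongly_below_iff:
  assumes "A \<subseteq> topspace X"
  shows "strongly_below (topspace X) \<delta> A C \<longleftrightarrow> cl A \<inter> cl (topspace X - C) = {}"
  using assms by (auto simp: strongly_below_def \<delta>_def)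

lemma trace_bounded: "compactin Y V \<Longrightarrow> trace V \<in> \<B>"
  using cl_trace_closed[of V] compactin_imp_closedin[OF Hausdorff, of V]
  by (auto simp: \<B>_def trace_subset intro: closed_compactin closedin_cl)

text \<open>Both (BC1) and zero-dimensionality come from a compact open set between \<open>cl A\<close> and the
  complement of \<open>cl (topspace X - C)\<close>.\<close>

lemma clopen_trace_between:
  assumes A: "A \<in> \<B>" and AC: "strongly_below (topspace X) \<delta> A C"
  obtains V where "openin Y V" "compactin Y V" "trace V \<in> \<B>" "A \<subseteq> trace V" "trace V \<subseteq> C"
    "strongly_below (topspace X) \<delta> A (trace V)" "strongly_below (topspace X) \<delta> (trace V) C"
    "strongly_below (topspace X) \<delta> (trace V) (trace V)"
proof -
  have AX: "A \<subseteq> topspace X" and cA: "compactin Y (cl A)" using A by (auto simp: \<B>_def)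
  have "cl A \<subseteq> topspace Y - cl (topspace X - C)"
    using AC AX cl_subset_topspace by (auto simp: strongly_below_iff)
  moreover have "openin Y (topspace Y - cl (topspace X - C))"
    by (simp add: closedin_cl openin_diff)
  ultimately obtain V where V: "openin Y V" "compactin Y V" "closedin Y V" "cl A \<subseteq> V"
      "V \<subseteq> topspace Y - cl (topspace X - C)"
    using compact_open_between[OF cA] by metis
  have tr: "cl (trace V) = V" using cl_trace_clopen V by blast
  \<comment> \<open>Because \<open>V\<close> is clopen, its complement is closed too, so the closure
    of the complementary trace stays off \<open>V\<close>. All three strong inclusions follow from
    this.\<close>
  have "topspace X - trace V = trace (topspace Y - V)"
    using f_in_topspace by (auto simp: trace_def)
  then have co: "cl (topspace X - trace V) \<subseteq> topspace Y - V"
    using cl_trace_closed[of "topspace Y - V"] V(1) by auto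
  have "A \<subseteq> trace V" using AX V(4) f_in_cl by (auto simp: trace_def)
  moreover have "trace V \<subseteq> C"
    using V(5) f_in_cl[of _ "topspace X - C"] by (auto simp: trace_def)
  moreover have "strongly_below (topspace X) \<delta> A (trace V)"
    using co V(4) AX by (auto simp: strongly_below_iff)
  moreover have "strongly_below (topspace X) \<delta> (trace V) C"
      "strongly_below (topspace X) \<delta> (trace V) (trace V)"
    using co tr V(5) trace_subset by (auto simp: strongly_below_iff)
  ultimately show thesis using that V trace_bounded by blast
qed

lemma ideal_\<B>: "ideal_on (topspace X) \<B>"
  unfolding ideal_on_def
proof (intro conjI allI impI ballI)
  show "\<B> \<subseteq> Pow (topspace X)" "{} \<in> \<B>" by (auto simp: \<B>_def)
  fix A C
  show "C \<in> \<B>" if "A \<in> \<B> \<and> C \<subseteq> A"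
    using that closed_compactin[OF _ cl_mono closedin_cl, of A C] by (auto simp: \<B>_def)
  show "A \<union> C \<in> \<B>" if "A \<in> \<B>" "C \<in> \<B>"
    using that by (auto simp: \<B>_def cl_Un compactin_Un)
qed

lemma local_proximity: "local_proximity (topspace X) \<delta> \<B>"
  unfolding local_proximity_def
proof (intro conjI allI impI ballI)
  show "ideal_on (topspace X) \<B>" by (rule ideal_\<B>)
  show "\<delta> \<subseteq> Pow (topspace X) \<times> Pow (topspace X)" by (auto simp: \<delta>_def)
  show "sym \<delta>" by (auto simp: sym_def \<delta>_def)
  fix A assume AX: "A \<subseteq> topspace X"
  show "({}, A) \<notin> \<delta>" by (simp add: \<delta>_def)
  show "(A, A) \<in> \<delta>" if "A \<noteq> {}" using that AX f_in_cl by (fastforce simp: \<delta>_def)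
  fix C assume CX: "C \<subseteq> topspace X"
  show "((A, C \<union> D) \<in> \<delta>) = ((A, C) \<in> \<delta> \<or> (A, D) \<in> \<delta>)" if "D \<subseteq> topspace X" for D
    using AX CX that by (auto simp: \<delta>_def cl_Un)
  assume "(A, C) \<in> \<delta>"
  then obtain y where y: "y \<in> cl A" "y \<in> cl C" by (auto simp: \<delta>_def)
  \<comment> \<open>For (BC2), cut \<open>C\<close> down to the trace of a compact neighbourhood of
    a common point \<open>y\<close>: the result is bounded and still has \<open>y\<close> in its
    closure.\<close>
  have "y \<in> topspace Y" using y(1) cl_subset_topspace by blast
  then obtain V where V: "openin Y V" "compactin Y V" "y \<in> V"
    using compact_open_base[of "topspace Y" y] by auto
  have "C \<inter> trace V \<in> \<B>" using trace_bounded[OF V(2)] ideal_\<B> unfolding ideal_on_def by blast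
  moreover have "y \<in> cl (C \<inter> trace V)" using in_cl_trace_Int y(2) CX V by blast
  ultimately show "\<exists>B\<in>\<B>. B \<subseteq> C \<and> (A, B) \<in> \<delta>"
    using y(1) AX CX by (intro bexI[of _ "C \<inter> trace V"]) (auto simp: \<delta>_def)
next
  fix A C assume "A \<in> \<B>" "strongly_below (topspace X) \<delta> A C"
  then obtain V where "trace V \<in> \<B>" "strongly_below (topspace X) \<delta> A (trace V)"
      "strongly_below (topspace X) \<delta> (trace V) C"
    by (rule clopen_trace_between)
  then show "\<exists>B\<in>\<B>. strongly_below (topspace X) \<delta> A B \<and> strongly_below (topspace X) \<delta> B C"
    by blast
qed

lemma cl_singleton: "x \<in> topspace X \<Longrightarrow> cl {x} = {f x}"
  using f_in_topspace
  by (simp add: cl_def closure_of_singleton Hausdorff_imp_t1_space Hausdorff)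

lemma ext_proximity_in_LP0: "(\<delta>, \<B>) \<in> LP0 X"
proof -
  have "separated_proximity (topspace X) \<delta>"
    using inj_f by (auto simp: separated_proximity_def \<delta>_def cl_singleton dest: inj_onD)
  moreover have "induces_topology \<delta> X"
    unfolding induces_topology_def
    by (auto simp: closure_of_eq_cl \<delta>_def cl_singleton)
  moreover have "zero_dimensional_proximity (topspace X) \<delta> \<B>"
    unfolding zero_dimensional_proximity_def
  proof (intro ballI impI)
    fix A C assume "A \<in> \<B>" "strongly_below (topspace X) \<delta> A C"
    then obtain V where "A \<subseteq> trace V" "trace V \<subseteq> C" "strongly_below (topspace X) \<delta> (trace V) (trace V)"
      by (rule clopen_trace_between)
    then show "\<exists>D\<subseteq>topspace X. A \<subseteq> D \<and> D \<subseteq> C \<and> strongly_below (topspace X) \<delta> D D"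
      using trace_subset by blast
  qed
  ultimately show ?thesis using local_proximity by (simp add: LP0_def)
qed

end

subsection \<open>Comparison of the orders\<close>

lemma ext_le_imp_LP0_le:
  assumes E1: "zlc_extension X (Y1, f1)" and E2: "zlc_extension X (Y2, f2)"
    and le: "ext_le X (Y1, f1) (Y2, f2)"
  shows "LP0_le (ext_proximity X (Y1, f1)) (ext_proximity X (Y2, f2))"
proof -
  interpret E1: zlc_ext X Y1 f1 by standard (rule E1)
  interpret E2: zlc_ext X Y2 f2 by standard (rule E2)
  obtain h where h: "continuous_map Y2 Y1 h" and hf: "\<And>x. x \<in> topspace X \<Longrightarrow> f1 x = h (f2 x)"
    using le by (auto simp: ext_le_def)
  have im: "h ` E2.cl A \<subseteq> E1.cl A" if "A \<subseteq> topspace X" for A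
  proof -
    have "h ` f2 ` A = f1 ` A" using hf that by (force simp: image_image)
    then show ?thesis
      using continuous_map_image_closure_subset[OF h, of "f2 ` A"]
      by (simp add: E1.cl_def E2.cl_def)
  qed
  have "E2.\<delta> \<subseteq> E1.\<delta>"
  proof (rule subrelI)
    fix A C assume "(A, C) \<in> E2.\<delta>"
    then obtain y where "y \<in> E2.cl A" "y \<in> E2.cl C" "A \<subseteq> topspace X" "C \<subseteq> topspace X"
      by (auto simp: E2.\<delta>_def)
    moreover from this have "h y \<in> E1.cl A" "h y \<in> E1.cl C" using im by blast+
    ultimately show "(A, C) \<in> E1.\<delta>" by (auto simp: E1.\<delta>_def)
  qed
  moreover have "E2.\<B> \<subseteq> E1.\<B>"
  proof
    fix A assume "A \<in> E2.\<B>"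
    then have AX: "A \<subseteq> topspace X" and cA: "compactin Y2 (E2.cl A)" by (auto simp: E2.\<B>_def)
    have k: "compactin Y1 (h ` E2.cl A)" using image_compactin[OF cA h] .
    have "f1 ` A \<subseteq> h ` E2.cl A" using hf AX E2.f_in_cl by blast
    then have "E1.cl A \<subseteq> h ` E2.cl A"
      unfolding E1.cl_def using compactin_imp_closedin[OF E1.Hausdorff k]
      by (rule closure_of_minimal)
    then show "A \<in> E1.\<B>"
      using closed_compactin[OF k _ E1.closedin_cl] AX by (simp add: E1.\<B>_def)
  qed
  ultimately show ?thesis
    by (simp add: E1.ext_proximity_eq E2.ext_proximity_eq LP0_le_def)
qed

text \<open>The map sends \<open>y\<close> to the unique cluster point in \<open>Y1\<close> of the trace on \<open>X\<close> of the
  neighbourhood filter of \<open>y\<close>: a bounded neighbourhood gives existence, and \<open>\<delta>2 \<subseteq> \<delta>1\<close> gives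
  uniqueness and continuity.\<close>

lemma LP0_le_imp_ext_le:
  assumes E1: "zlc_extension X (Y1, f1)" and E2: "zlc_extension X (Y2, f2)"
    and le: "LP0_le (ext_proximity X (Y1, f1)) (ext_proximity X (Y2, f2))"
  shows "ext_le X (Y1, f1) (Y2, f2)"
proof -
  interpret E1: zlc_ext X Y1 f1 by standard (rule E1)
  interpret E2: zlc_ext X Y2 f2 by standard (rule E2)
  have \<delta>: "E2.\<delta> \<subseteq> E1.\<delta>" and \<B>: "E2.\<B> \<subseteq> E1.\<B>"
    using le by (simp_all add: E1.ext_proximity_eq E2.ext_proximity_eq LP0_le_def)
  define G where "G y z \<longleftrightarrow> (\<forall>V. openin Y2 V \<and> y \<in> V \<longrightarrow> z \<in> E1.cl (E2.trace V))" for y z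
  have ex: "\<exists>z. G y z" if y: "y \<in> topspace Y2" for y
  proof -
    obtain K where K: "openin Y2 K" "compactin Y2 K" "y \<in> K"
      using E2.compact_open_base[of "topspace Y2" y] y by auto
    have "E2.trace K \<in> E1.\<B>" using E2.trace_bounded K(2) \<B> by blast
    then have cK: "compactin Y1 (E1.cl (E2.trace K))" by (simp add: E1.\<B>_def)
    let ?\<U> = "{E1.cl (E2.trace V) |V. openin Y2 V \<and> y \<in> V}"
    \<comment> \<open>Finite intersection property: finitely many neighbourhoods of \<open>y\<close>
      and \<open>K\<close> meet in an open set, which by density contains some \<open>f2 x\<close>;
      then \<open>f1 x\<close> lies in all the closures.\<close>
    have "E1.cl (E2.trace K) \<inter> \<Inter>\<F> \<noteq> {}" if \<F>: "finite \<F>" "\<F> \<subseteq> ?\<U>" for \<F>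
    proof -
      have sub: "\<F> \<subseteq> (\<lambda>V. E1.cl (E2.trace V)) ` {V. openin Y2 V \<and> y \<in> V}"
        using \<F>(2) by blast
      obtain \<V> where \<V>: "\<V> \<subseteq> {V. openin Y2 V \<and> y \<in> V}" "finite \<V>"
          "\<F> = (\<lambda>V. E1.cl (E2.trace V)) ` \<V>"
        using finite_subset_image[OF \<F>(1) sub] by blast
      let ?W = "\<Inter>(insert K \<V>)"
      have W: "openin Y2 ?W" "y \<in> ?W"
        by (rule openin_Inter) (use \<V> K in auto)
      have "E2.cl (E2.trace ?W) \<noteq> {}" using E2.open_subset_cl_trace[OF W(1)] W(2) by blast
      then obtain x where x: "x \<in> E2.trace ?W" by fastforce
      then have "f1 x \<in> E1.cl (E2.trace V)" if "V \<in> insert K \<V>" for V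
        using that E1.f_in_cl[of x "E2.trace V"] E2.trace_subset by (auto simp: E2.trace_def)
      then show ?thesis using \<V>(3) by blast
    qed
    moreover have "\<forall>C\<in>?\<U>. closedin Y1 C" using E1.closedin_cl by blast
    ultimately have "E1.cl (E2.trace K) \<inter> \<Inter>?\<U> \<noteq> {}"
      using cK unfolding compactin_fip by meson
    then show ?thesis unfolding G_def by blast
  qed
  \<comment> \<open>Continuity of the relation \<open>G\<close>, shown before it is known to be
    single-valued; taking \<open>y' = y\<close> then yields uniqueness in the Hausdorff space
    \<open>Y1\<close>.\<close>
  have nbhd: "\<exists>V. openin Y2 V \<and> y \<in> V \<and> (\<forall>y'\<in>V. \<forall>z'. G y' z' \<longrightarrow> z' \<in> U)"
    if y: "y \<in> topspace Y2" and z: "G y z" "openin Y1 U" "z \<in> U" for y z U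
  proof -
    obtain W where W: "openin Y1 W" "compactin Y1 W" "z \<in> W" "W \<subseteq> U"
      using E1.compact_open_base z by metis
    have cW: "closedin Y1 W" using compactin_imp_closedin E1.Hausdorff W(2) by blast
    \<comment> \<open>The compact open \<open>W\<close> splits \<open>X\<close> into two parts that
      are far for \<open>E1.\<delta>\<close>, hence far for \<open>E2.\<delta>\<close>. Their
      closures therefore split \<open>Y2\<close> into two clopen halves, and the half containing
      \<open>y\<close> is the required neighbourhood.\<close>
    let ?A = "E1.trace W" and ?A' = "E1.trace (topspace Y1 - W)"
    have un: "?A \<union> ?A' = topspace X" using E1.f_in_topspace by (auto simp: E1.trace_def)
    have c1: "E1.cl ?A \<subseteq> W" "E1.cl ?A' \<subseteq> topspace Y1 - W"
      using E1.cl_trace_closed cW W(1) by auto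
    then have "(?A, ?A') \<notin> E1.\<delta>" by (auto simp: E1.\<delta>_def)
    then have "(?A, ?A') \<notin> E2.\<delta>" using \<delta> by blast
    then have dis: "E2.cl ?A \<inter> E2.cl ?A' = {}" by (simp add: E2.\<delta>_def E1.trace_subset)
    have cov: "E2.cl ?A \<union> E2.cl ?A' = topspace Y2"
      using un E2.cl_topspace by (simp flip: E2.cl_Un)
    have "E2.cl ?A = topspace Y2 - E2.cl ?A'" "E2.cl ?A' = topspace Y2 - E2.cl ?A"
      using dis cov by blast+
    then have op: "openin Y2 (E2.cl ?A)" "openin Y2 (E2.cl ?A')"
      using E2.closedin_cl by (metis openin_diff openin_topspace)+
    have tr: "E2.trace (E2.cl ?A) \<subseteq> ?A" "E2.trace (E2.cl ?A') \<subseteq> ?A'"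
      using dis un E2.f_in_cl[OF _ E1.trace_subset] by (fastforce simp: E2.trace_def)+
    have "y \<in> E2.cl ?A"
    proof (rule ccontr)
      assume "y \<notin> E2.cl ?A"
      then have "y \<in> E2.cl ?A'" using cov y by blast
      then have "z \<in> E1.cl (E2.trace (E2.cl ?A'))" using z(1) op(2) by (simp add: G_def)
      then show False using E1.cl_mono[OF tr(2)] c1(2) W(3) by blast
    qed
    moreover have "z' \<in> U" if "y' \<in> E2.cl ?A" "G y' z'" for y' z'
    proof -
      have "z' \<in> E1.cl (E2.trace (E2.cl ?A))" using that op(1) by (simp add: G_def)
      then show ?thesis using E1.cl_mono[OF tr(1)] c1(1) W(4) by blast
    qed
    ultimately show ?thesis using op(1) by blast
  qed
  have G_top: "z \<in> topspace Y1" if "G y z" "y \<in> topspace Y2" for y z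
    using that E1.cl_subset_topspace unfolding G_def by blast
  have uniq: "z = z'" if y: "y \<in> topspace Y2" and G: "G y z" "G y z'" for y z z'
  proof (rule ccontr)
    assume "z \<noteq> z'"
    then obtain U U' where "openin Y1 U" "z \<in> U" "z' \<in> U'" "disjnt U U'"
      using E1.Hausdorff G G_top y unfolding Hausdorff_space_def by metis
    then show False using nbhd[OF y G(1)] y G(2) by (metis disjnt_iff)
  qed
  define h where "h y = (SOME z. G y z)" for y
  have h: "G y (h y)" if "y \<in> topspace Y2" for y
    unfolding h_def using ex[OF that] by (rule someI_ex)
  have "continuous_map Y2 Y1 h"
    unfolding continuous_map
  proof (intro conjI allI impI)
    show "h ` topspace Y2 \<subseteq> topspace Y1" using h G_top by blast
    fix U assume U: "openin Y1 U"
    show "openin Y2 {y \<in> topspace Y2. h y \<in> U}"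
    proof (subst openin_subopen, intro ballI)
      fix y assume "y \<in> {y \<in> topspace Y2. h y \<in> U}"
      then obtain V where V: "openin Y2 V" "y \<in> V" "\<forall>y'\<in>V. \<forall>z'. G y' z' \<longrightarrow> z' \<in> U"
        using nbhd[of y "h y" U] h U by blast
      then have "V \<subseteq> {y \<in> topspace Y2. h y \<in> U}" using h openin_subset[OF V(1)] by blast
      then show "\<exists>V. openin Y2 V \<and> y \<in> V \<and> V \<subseteq> {y \<in> topspace Y2. h y \<in> U}" using V by blast
    qed
  qed
  moreover have "f1 x = h (f2 x)" if x: "x \<in> topspace X" for x
  proof (rule uniq)
    show y: "f2 x \<in> topspace Y2" using x E2.f_in_topspace by blast
    show "G (f2 x) (h (f2 x))" using h y by blast
    \<comment> \<open>The point \<open>x\<close> itself belongs to the trace of every neighbourhood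
      of \<open>f2 x\<close>.\<close>
    show "G (f2 x) (f1 x)"
      unfolding G_def using x E1.f_in_cl E2.trace_subset by (auto simp: E2.trace_def)
  qed
  ultimately show ?thesis by (auto simp: ext_le_def)
qed

lemma ext_le_iff:
  assumes "zlc_extension X (Y1, f1)" "zlc_extension X (Y2, f2)"
  shows "ext_le X (Y1, f1) (Y2, f2) \<longleftrightarrow>
    LP0_le (ext_proximity X (Y1, f1)) (ext_proximity X (Y2, f2))"
  using ext_le_imp_LP0_le[OF assms] LP0_le_imp_ext_le[OF assms] by blast

lemma LP0_le_antisym: "LP0_le p q \<Longrightarrow> LP0_le q p \<Longrightarrow> p = q"
  by (auto simp: LP0_le_def split: prod.splits)

lemma ext_proximity_LP0:
  assumes "zlc_extension X E" shows "ext_proximity X E \<in> LP0 X"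
proof -
  interpret zlc_ext X "fst E" "snd E" by standard (simp add: assms)
  show ?thesis using ext_proximity_in_LP0 ext_proximity_eq by simp
qed

subsection \<open>The extension of a local proximity\<close>

locale zero_dim_proximity =
  fixes X :: "'a topology" and \<delta> :: "'a set rel" and \<B> :: "'a set set"
  assumes in_LP0: "(\<delta>, \<B>) \<in> LP0 X"
begin

abbreviation below (infix "\<lless>" 50) where
  "A \<lless> C \<equiv> strongly_below (topspace X) \<delta> A C"

lemma LP: "local_proximity (topspace X) \<delta> \<B>"
  and separated: "separated_proximity (topspace X) \<delta>"
  and induces: "induces_topology \<delta> X"
  and zero_dim: "zero_dimensional_proximity (topspace X) \<delta> \<B>"
  using in_LP0 by (auto simp: LP0_def)

lemma ideal: "ideal_on (topspace X) \<B>"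
  and prox_Pow: "\<delta> \<subseteq> Pow (topspace X) \<times> Pow (topspace X)"
  and sym_prox: "sym \<delta>"
  and P1: "\<forall>A\<subseteq>topspace X. ({}, A) \<notin> \<delta>"
  and P2: "\<forall>A\<subseteq>topspace X. A \<noteq> {} \<longrightarrow> (A, A) \<in> \<delta>"
  and P3: "\<forall>A\<subseteq>topspace X. \<forall>B\<subseteq>topspace X. \<forall>C\<subseteq>topspace X.
    (A, B \<union> C) \<in> \<delta> \<longleftrightarrow> (A, B) \<in> \<delta> \<or> (A, C) \<in> \<delta>"
  and BC1: "\<forall>A\<in>\<B>. \<forall>C\<subseteq>topspace X. A \<lless> C \<longrightarrow> (\<exists>B\<in>\<B>. A \<lless> B \<and> B \<lless> C)"
  and BC2: "\<forall>A\<subseteq>topspace X. \<forall>C\<subseteq>topspace X. (A, C) \<in> \<delta> \<longrightarrow>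
    (\<exists>B\<in>\<B>. B \<subseteq> C \<and> (A, B) \<in> \<delta>)"
  using LP unfolding local_proximity_def by - (elim conjE, assumption)+

lemma bounded_subset_topspace: "A \<in> \<B> \<Longrightarrow> A \<subseteq> topspace X"
  and bounded_empty: "{} \<in> \<B>"
  and bounded_subset: "A \<in> \<B> \<Longrightarrow> C \<subseteq> A \<Longrightarrow> C \<in> \<B>"
  and bounded_Un: "A \<in> \<B> \<Longrightarrow> C \<in> \<B> \<Longrightarrow> A \<union> C \<in> \<B>"
  using ideal unfolding ideal_on_def by blast+

lemma prox_subset: "(A, C) \<in> \<delta> \<Longrightarrow> A \<subseteq> topspace X \<and> C \<subseteq> topspace X"
  using prox_Pow by blast

lemma prox_sym: "(A, C) \<in> \<delta> \<Longrightarrow> (C, A) \<in> \<delta>"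
  using sym_prox by (rule symD)

lemma prox_empty: "({}, A) \<notin> \<delta>"
  using P1 prox_subset by blast

lemma prox_refl: "A \<subseteq> topspace X \<Longrightarrow> A \<noteq> {} \<Longrightarrow> (A, A) \<in> \<delta>"
  using P2 by blast

lemma prox_Un:
  "A \<subseteq> topspace X \<Longrightarrow> C \<subseteq> topspace X \<Longrightarrow> D \<subseteq> topspace X \<Longrightarrow>
    (A, C \<union> D) \<in> \<delta> \<longleftrightarrow> (A, C) \<in> \<delta> \<or> (A, D) \<in> \<delta>"
  using P3 by simp

lemma prox_bounded: "(A, C) \<in> \<delta> \<Longrightarrow> \<exists>B\<in>\<B>. B \<subseteq> C \<and> (A, B) \<in> \<delta>"
  using BC2 prox_subset by simp

lemma prox_mono_right:
  assumes "(A, C) \<in> \<delta>" "C \<subseteq> C'" "C' \<subseteq> topspace X"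
  shows "(A, C') \<in> \<delta>"
  using prox_Un[of A C C'] prox_subset[OF assms(1)] assms by (simp add: sup.absorb2)

lemma prox_mono:
  assumes "(A, C) \<in> \<delta>" "A \<subseteq> A'" "C \<subseteq> C'" "A' \<subseteq> topspace X" "C' \<subseteq> topspace X"
  shows "(A', C') \<in> \<delta>"
  using assms prox_mono_right prox_sym by metis

lemma prox_Int:
  assumes "A \<inter> C \<noteq> {}" "A \<subseteq> topspace X" "C \<subseteq> topspace X"
  shows "(A, C) \<in> \<delta>"
  by (rule prox_mono[of "A \<inter> C" "A \<inter> C"]) (use assms prox_refl[of "A \<inter> C"] in blast)+

lemma below_imp_subset: "A \<lless> C \<Longrightarrow> A \<subseteq> topspace X \<Longrightarrow> A \<subseteq> C"
  using prox_Int[of A "topspace X - C"] by (auto simp: strongly_below_def)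

text \<open>For the proximity of an extension these are exactly the traces of the compact open sets.
  They form a ring of sets, possibly without a largest element, so complements are taken only
  relative to members.\<close>

definition R :: "'a set set" where
  "R = {C \<in> \<B>. C \<lless> C}"

lemma R_bounded: "C \<in> R \<Longrightarrow> C \<in> \<B>"
  and R_subset: "C \<in> R \<Longrightarrow> C \<subseteq> topspace X"
  by (auto simp: R_def dest: bounded_subset_topspace)

lemma not_prox_R:
  assumes "D \<in> R" "A \<subseteq> D" "C \<subseteq> topspace X" "C \<inter> D = {}"
  shows "(A, C) \<notin> \<delta>"
proof
  assume "(A, C) \<in> \<delta>"
  then have "(D, topspace X - D) \<in> \<delta>"
    by (rule prox_mono) (use assms R_subset in auto)
  then show False using assms(1) by (simp add: R_def strongly_below_def)
qed

lemma R_empty: "{} \<in> R"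
  by (simp add: R_def strongly_below_def prox_empty bounded_empty)

lemma R_Un:
  assumes "C \<in> R" "D \<in> R" shows "C \<union> D \<in> R"
proof -
  let ?E = "topspace X - (C \<union> D)"
  have "(C, ?E) \<notin> \<delta>" "(D, ?E) \<notin> \<delta>"
    by (rule not_prox_R[OF assms(1)] not_prox_R[OF assms(2)]; blast)+
  then have "(?E, C) \<notin> \<delta>" "(?E, D) \<notin> \<delta>" using prox_sym by blast+
  then have "(?E, C \<union> D) \<notin> \<delta>"
    using assms R_subset by (subst prox_Un) auto
  then show ?thesis
    using assms prox_sym bounded_Un by (auto simp: R_def strongly_below_def)
qed

text \<open>The complement of \<open>C - D\<close> is \<open>(topspace X - C) \<union> D\<close>.
  The set \<open>C - D\<close> is far from the first part because \<open>C\<close> is in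
  \<open>R\<close>, and from the second because \<open>D\<close> is.\<close>

lemma R_Diff:
  assumes "C \<in> R" "D \<in> R" shows "C - D \<in> R"
proof -
  have sub: "C \<subseteq> topspace X" "D \<subseteq> topspace X" using assms R_subset by auto
  have "(C - D, topspace X - C) \<notin> \<delta>"
    by (rule not_prox_R[OF assms(1)]) auto
  moreover have "(D, C - D) \<notin> \<delta>"
    by (rule not_prox_R[OF assms(2)]) (use sub in auto)
  then have "(C - D, D) \<notin> \<delta>" using prox_sym by blast
  ultimately have "(C - D, (topspace X - C) \<union> D) \<notin> \<delta>"
    using sub by (subst prox_Un) auto
  then have "C - D \<lless> C - D"
    using prox_mono_right[of "C - D" "topspace X - (C - D)" "(topspace X - C) \<union> D"] sub
    unfolding strongly_below_def by blast
  moreover have "C - D \<in> \<B>" using assms(1) R_bounded bounded_subset by blast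
  ultimately show ?thesis by (simp add: R_def)
qed

lemma R_Int: "C \<in> R \<Longrightarrow> D \<in> R \<Longrightarrow> C \<inter> D \<in> R"
  using R_Diff[of C "C - D"] R_Diff[of C D] by (simp add: Diff_Diff_Int)

text \<open>With \<open>not_prox_R\<close> this shows that \<open>R\<close> decides which sets are
  near a bounded set.\<close>

lemma R_separates:
  assumes A: "A \<in> \<B>" and C: "C \<subseteq> topspace X" and AC: "(A, C) \<notin> \<delta>"
  obtains D where "D \<in> R" "A \<subseteq> D" "D \<inter> C = {}"
proof -
  have "topspace X - (topspace X - C) = C" using C by blast
  then have "A \<lless> topspace X - C" using AC by (simp add: strongly_below_def)
  \<comment> \<open>Zero-dimensionality speaks only of pairs of bounded sets, so (BC1) first
    supplies a bounded \<open>B\<close> in between; the \<open>D\<close> found below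
    \<open>B\<close> is then bounded as well.\<close>
  then obtain B where B: "B \<in> \<B>" "A \<lless> B" "B \<lless> topspace X - C" 
    using BC1 A by (meson Diff_subset)
  obtain D where D: "A \<subseteq> D" "D \<subseteq> B" "D \<lless> D"
    using zero_dim A B unfolding zero_dimensional_proximity_def by blast
  have "B \<subseteq> topspace X - C" using below_imp_subset B bounded_subset_topspace by blast
  moreover have "D \<in> R" using D B bounded_subset by (auto simp: R_def)
  ultimately show thesis using that D by blast
qed

lemma bounded_in_R: "A \<in> \<B> \<Longrightarrow> \<exists>C\<in>R. A \<subseteq> C"
  using R_separates[of A "{}"] prox_empty prox_sym by (metis empty_subsetI)

text \<open>By (BC2), \<open>{x}\<close> is near a bounded subset of itself, and that subset cannot
  be empty.\<close>

lemma singleton_bounded: "x \<in> topspace X \<Longrightarrow> {x} \<in> \<B>"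
  using prox_bounded[OF prox_refl[of "{x}"]] prox_empty prox_sym by (metis empty_not_insert
      empty_subsetI insert_subset subset_singletonD)

text \<open>The complement of \<open>U\<close> is closed in the induced topology, so it is far from
  \<open>{x}\<close>, and \<open>R_separates\<close> applies to the bounded set
  \<open>{x}\<close>.\<close>

lemma R_base:
  assumes "openin X U" "x \<in> U"
  obtains C where "C \<in> R" "x \<in> C" "C \<subseteq> U"
proof -
  have U: "U \<subseteq> topspace X" using assms openin_subset by blast
  have "X closure_of (topspace X - U) = topspace X - U"
    using assms by (simp add: closure_of_closedin openin_closedin_eq)
  then have "({x}, topspace X - U) \<notin> \<delta>"
    using induces assms(2) U unfolding induces_topology_def by (metis (no_types, lifting)
        Diff_iff Diff_subset mem_Collect_eq subsetD)
  then obtain D where "D \<in> R" "{x} \<subseteq> D" "D \<inter> (topspace X - U) = {}"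
    using R_separates[OF singleton_bounded] U assms(2) by blast
  then show thesis using that R_subset by blast
qed

lemma R_separates_points:
  assumes "x \<in> topspace X" "y \<in> topspace X" "x \<noteq> y"
  obtains C where "C \<in> R" "x \<in> C" "y \<notin> C"
  using R_separates[OF singleton_bounded[OF assms(1)], of "{y}"] separated assms
  unfolding separated_proximity_def by auto

lemma closedin_R:
  assumes "C \<in> R" shows "closedin X C"
proof -
  have "x \<in> C" if "x \<in> topspace X" "({x}, C) \<in> \<delta>" for x
    using not_prox_R[OF assms, of C "{x}"] that prox_sym by blast
  moreover have "x \<in> topspace X \<and> ({x}, C) \<in> \<delta>" if "x \<in> C" for x
    using that R_subset[OF assms] prox_Int by blast
  ultimately have "X closure_of C = C"
    using induces R_subset[OF assms] unfolding induces_topology_def by blast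
  then show ?thesis by (metis closedin_closure_of)
qed

lemma openin_R:
  assumes C: "C \<in> R" shows "openin X C"
proof -
  have "X closure_of (topspace X - C) = {x \<in> topspace X. ({x}, topspace X - C) \<in> \<delta>}"
    using induces unfolding induces_topology_def by simp
  also have "\<dots> = topspace X - C"
    using not_prox_R[OF C, of "{_}" "topspace X - C"] prox_Int[of "{_}" "topspace X - C"] by auto
  finally have "closedin X (topspace X - C)" by (metis closedin_closure_of)
  then show ?thesis using R_subset[OF C] by (simp add: openin_closedin)
qed

section \<open>The closure of \<open>X\<close> in the Cantor cube\<close>

abbreviation cube :: "('a set \<Rightarrow> bool) topology" where
  "cube \<equiv> product_topology (\<lambda>_. discrete_topology UNIV) UNIV"

text \<open>The cube has a coordinate for every set, which avoids partial functions. Coordinates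
  outside \<open>R\<close> are made constantly false, and this passes to the closure, so in effect
  only those in \<open>R\<close> count.\<close>

definition e :: "'a \<Rightarrow> 'a set \<Rightarrow> bool" where
  "e x = (\<lambda>C. C \<in> R \<and> x \<in> C)"

definition Q :: "('a set \<Rightarrow> bool) set" where
  "Q = cube closure_of (e ` topspace X)"

text \<open>The all-false point, if it lies in \<open>Q\<close>, is a point at infinity. Without it,
  every point lies in one of the sets \<open>K C\<close>, which are compact and open.\<close>

definition Y :: "('a set \<Rightarrow> bool) topology" where
  "Y = subtopology cube (Q \<inter> {p. \<exists>C. p C})"

definition K :: "'a set \<Rightarrow> ('a set \<Rightarrow> bool) set" where
  "K C = {p \<in> topspace Y. p C}"

lemma topspace_Y: "topspace Y = Q \<inter> {p. \<exists>C. p C}"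
  by (simp add: Y_def)

lemma openin_cube_coordinate: "openin cube {p. p C = b}"
  using openin_continuous_map_preimage[OF continuous_map_product_projection[of C UNIV
        "\<lambda>_. discrete_topology UNIV"], of "{b}"] by simp

lemma closedin_cube_coordinate: "closedin cube {p. p C}"
proof -
  have "UNIV - {p. p C} = {p. p C = False}" by auto
  then show ?thesis using openin_cube_coordinate[of C False] by (simp add: closedin_def)
qed

text \<open>Fixing finitely many coordinates is an open condition, so it is met by some
  \<open>e x\<close>. Hence Boolean identities in finitely many coordinates that hold for all
  \<open>e x\<close> hold throughout \<open>Q\<close>.\<close>

lemma Q_agree:
  assumes "p \<in> Q" "finite F"
  obtains x where "x \<in> topspace X" "\<And>C. C \<in> F \<Longrightarrow> p C = e x C"
proof -
  \<comment> \<open>Inserting \<open>UNIV\<close> keeps the intersected family nonempty when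
    \<open>F\<close> is empty.\<close>
  let ?U = "\<Inter>(insert UNIV ((\<lambda>C. {q. q C = p C}) ` F))"
  have "openin cube UNIV" using openin_topspace[of cube] by simp
  then have "openin cube ?U"
    using assms(2) openin_cube_coordinate by (intro openin_Inter) auto
  moreover have "p \<in> ?U" by simp
  ultimately obtain q where "q \<in> e ` topspace X" "q \<in> ?U"
    using assms(1) unfolding Q_def in_closure_of by blast
  then show thesis using that by auto
qed

lemma openin_cube_agree:
  assumes "openin cube U" "p \<in> U"
  obtains F where "finite F" "\<And>q. (\<And>C. C \<in> F \<Longrightarrow> q C = p C) \<Longrightarrow> q \<in> U"
proof -
  obtain V :: "'a set \<Rightarrow> bool set" where V: "finite {i. V i \<noteq> UNIV}" "p \<in> Pi\<^sub>E UNIV V" "Pi\<^sub>E UNIV V \<subseteq> U"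
    using assms unfolding openin_product_topology_alt by auto
  have "q \<in> U" if "\<And>C. C \<in> {i. V i \<noteq> UNIV} \<Longrightarrow> q C = p C" for q
  proof -
    have "q C \<in> V C" for C using that[of C] V(2) by (cases "V C = UNIV") (auto simp: PiE_iff)
    then show ?thesis using V(3) by (auto simp: PiE_iff)
  qed
  then show thesis using that V(1) by blast
qed

lemma Y_imp_R:
  assumes "p \<in> topspace Y" "p C" shows "C \<in> R"
proof -
  have "p \<in> Q" using assms topspace_Y by blast
  then obtain x where "p C = e x C" using Q_agree[of p "{C}"] by auto
  then show ?thesis using assms(2) by (simp add: e_def)
qed

lemma openin_K: "openin Y (K C)"
proof -
  have "K C = {p. p C = True} \<inter> (Q \<inter> {p. \<exists>C. p C})" by (auto simp: K_def topspace_Y)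
  then show ?thesis
    unfolding Y_def openin_subtopology using openin_cube_coordinate[of C True] by auto
qed

lemma compactin_K: "compactin Y (K C)"
proof -
  have "compact_space cube"
    by (simp add: compact_space_product_topology compact_space_discrete_topology)
  moreover have "closedin cube (Q \<inter> {p. p C})"
    by (simp add: Q_def closedin_Int closedin_cube_coordinate)
  ultimately have "compactin cube (Q \<inter> {p. p C})"
    using closedin_compact_space by blast
  \<comment> \<open>The condition \<open>p C\<close> already excludes the all-false point, so
    \<open>K C\<close> is closed in the whole compact cube.\<close>
  moreover have "K C = Q \<inter> {p. p C}" by (auto simp: K_def topspace_Y)
  ultimately show ?thesis by (auto simp: Y_def compactin_subtopology)
qed

lemma Hausdorff_Y: "Hausdorff_space Y"
  unfolding Y_def
  by (intro Hausdorff_space_subtopology) (simp add: Hausdorff_space_product_topology)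

lemma closedin_K: "closedin Y (K C)"
  using compactin_K Hausdorff_Y compactin_imp_closedin by blast

lemma e_in_Y:
  assumes "x \<in> topspace X" shows "e x \<in> topspace Y"
proof -
  obtain C where "C \<in> R" "x \<in> C" using R_base[of "topspace X" x] assms by auto
  then have "e x C" by (simp add: e_def)
  moreover have "e x \<in> Q"
    unfolding Q_def using assms closure_of_subset[of "e ` topspace X" cube] by auto
  ultimately show ?thesis by (auto simp: topspace_Y)
qed

lemma e_in_K: "x \<in> topspace X \<Longrightarrow> C \<in> R \<Longrightarrow> e x \<in> K C \<longleftrightarrow> x \<in> C"
  using e_in_Y[of x] by (simp add: K_def) (simp add: e_def)

lemma K_Un:
  assumes "C \<in> R" "D \<in> R" shows "K (C \<union> D) = K C \<union> K D"
proof -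
  have "p (C \<union> D) \<longleftrightarrow> p C \<or> p D" if "p \<in> topspace Y" for p
  proof -
    have "p \<in> Q" using that topspace_Y by blast
    then obtain x where "\<And>E. E \<in> {C, D, C \<union> D} \<Longrightarrow> p E = e x E"
      using Q_agree[of p "{C, D, C \<union> D}"] by blast
    then show ?thesis using assms R_Un by (simp add: e_def)
  qed
  then show ?thesis by (auto simp: K_def)
qed

text \<open>A neighbourhood of \<open>p\<close> prescribes finitely many coordinates, and the ring
  operations compress these conditions into a single member of \<open>R\<close>.\<close>

lemma K_base:
  assumes U: "openin Y U" and p: "p \<in> U"
  obtains C where "C \<in> R" "p \<in> K C" "K C \<subseteq> U"
proof -
  have pY: "p \<in> topspace Y" using U p openin_subset by blast
  obtain U' where U': "openin cube U'" "U = U' \<inter> topspace Y"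
    using U unfolding Y_def openin_subtopology by auto
  obtain F where F: "finite F" "\<And>q. (\<And>C. C \<in> F \<Longrightarrow> q C = p C) \<Longrightarrow> q \<in> U'"
    using openin_cube_agree[OF U'(1), of p] U'(2) p by blast
  \<comment> \<open>As \<open>p\<close> is not the all-false point, the induction can start from
    \<open>C0\<close>, a member of \<open>R\<close> to which negative conditions are made
    relative.\<close>
  obtain C0 where C0: "p C0" using pY topspace_Y by blast
  have "\<exists>C\<in>R. p C \<and> (\<forall>q\<in>topspace Y. q C \<longrightarrow> (\<forall>D\<in>F. q D = p D))"
    using F(1)
  proof (induction F rule: finite_induct)
    case empty
    show ?case using C0 Y_imp_R pY by blast
  next
    case (insert D F)
    obtain C where C: "C \<in> R" "p C" "\<forall>q\<in>topspace Y. q C \<longrightarrow> (\<forall>E\<in>F. q E = p E)"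
      using insert.IH by blast
    \<comment> \<open>If \<open>D\<close> is outside \<open>R\<close>, its coordinate is false at
      every point of \<open>Y\<close>, so the condition at \<open>D\<close> holds
      automatically.\<close>
    define C' where "C' = (if p D then C \<inter> D else if D \<in> R then C - D else C)"
    have C'R: "C' \<in> R"
      using C(1) R_Int R_Diff Y_imp_R[OF pY, of D] by (auto simp: C'_def)
    have eq: "q C' \<longleftrightarrow> q C \<and> q D = p D" if q: "q \<in> topspace Y" for q
    proof -
      have "q \<in> Q" using q topspace_Y by blast
      then obtain x where "\<And>E. E \<in> {C, D, C'} \<Longrightarrow> q E = e x E"
        using Q_agree[of q "{C, D, C'}"] by blast
      then show ?thesis
        using C(1) C'R Y_imp_R[OF pY, of D] by (auto simp: e_def C'_def)
    qed
    have "p C'" using eq[OF pY] C(2) by simp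
    moreover have "\<forall>q\<in>topspace Y. q C' \<longrightarrow> (\<forall>E\<in>insert D F. q E = p E)"
    proof (intro ballI impI)
      fix q E assume "q \<in> topspace Y" "q C'" "E \<in> insert D F"
      then show "q E = p E" using eq[of q] C(3) by auto
    qed
    ultimately show ?case using C'R by blast
  qed
  then obtain C where C: "C \<in> R" "p C" "\<forall>q\<in>topspace Y. q C \<longrightarrow> (\<forall>D\<in>F. q D = p D)" by blast
  have "q \<in> U" if "q \<in> K C" for q
    using that C(3) F(2)[of q] U'(2) by (simp add: K_def)
  moreover have "p \<in> K C" using pY C(2) by (simp add: K_def)
  ultimately show thesis using that C(1) by blast
qed

section \<open>The embedding of \<open>X\<close> and the recovery of its proximity\<close>

lemma continuous_e: "continuous_map X Y e"
proof -
  have "continuous_map X (discrete_topology UNIV) (\<lambda>x. e x C)" for C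
  proof -
    have "openin X {x \<in> topspace X. e x C = b}" for b
    proof (cases "C \<in> R")
      case True
      then have "{x \<in> topspace X. e x C = b} = (if b then C else topspace X - C)"
        using R_subset by (auto simp: e_def)
      then show ?thesis using openin_R closedin_R True by (simp add: openin_diff)
    next
      case False
      then show ?thesis by (cases b) (auto simp: e_def)
    qed
    then have "openin X (\<Union>b\<in>V. {x \<in> topspace X. e x C = b})" for V by blast
    moreover have "(\<Union>b\<in>V. {x \<in> topspace X. e x C = b}) = {x \<in> topspace X. e x C \<in> V}" for V
      by blast
    ultimately have "openin X {x \<in> topspace X. e x C \<in> V}" for V by metis
    then show ?thesis by (simp add: continuous_map_def)
  qed
  then have "continuous_map X cube e" by (simp add: continuous_map_componentwise_UNIV)
  then show ?thesis
    unfolding Y_def using e_in_Y topspace_Y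
    by (intro continuous_map_into_subtopology) auto
qed

text \<open>Injectivity holds because \<open>R\<close> separates points. Openness onto the image
  holds because \<open>R\<close> is a base of \<open>X\<close> and, for \<open>C\<close> in
  \<open>R\<close>, the trace of the open set \<open>K C\<close> is \<open>C\<close>.\<close>

lemma embedding_e: "embedding_map X Y e"
  unfolding embedding_map_def
proof (rule bijective_open_imp_homeomorphic_map)
  have sub: "e ` topspace X \<subseteq> topspace Y" using e_in_Y by blast
  show "continuous_map X (subtopology Y (e ` topspace X)) e"
    using continuous_e by (intro continuous_map_into_subtopology) auto
  show "e ` topspace X = topspace (subtopology Y (e ` topspace X))" using sub by auto
  show "inj_on e (topspace X)"
  proof (rule inj_onI, rule ccontr)
    fix x y assume xy: "x \<in> topspace X" "y \<in> topspace X" "e x = e y" "x \<noteq> y"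
    then obtain C where "C \<in> R" "x \<in> C" "y \<notin> C" using R_separates_points by metis
    then show False using xy(3) by (metis e_def)
  qed
  show "open_map X (subtopology Y (e ` topspace X)) e"
    unfolding open_map_def
  proof (intro allI impI)
    fix U assume U: "openin X U"
    show "openin (subtopology Y (e ` topspace X)) (e ` U)"
    proof (subst openin_subopen, intro ballI)
      fix p assume "p \<in> e ` U"
      then obtain x where x: "x \<in> U" "p = e x" by blast
      obtain C where C: "C \<in> R" "x \<in> C" "C \<subseteq> U" using R_base U x by metis
      have "openin (subtopology Y (e ` topspace X)) (K C \<inter> e ` topspace X)"
        using openin_K by (rule openin_subtopology_Int)
      moreover have "p \<in> K C \<inter> e ` topspace X"
        using x C e_in_K R_subset by blast
      moreover have "K C \<inter> e ` topspace X \<subseteq> e ` U"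
        using C e_in_K by blast
      ultimately show "\<exists>T. openin (subtopology Y (e ` topspace X)) T \<and> p \<in> T \<and> T \<subseteq> e ` U"
        by blast
    qed
  qed
qed

lemma zlc_extension_Y: "zlc_extension X (Y, e)"
proof -
  have sub: "e ` topspace X \<subseteq> topspace Y" using e_in_Y by blast
  have "Y closure_of (e ` topspace X) = topspace Y"
    using sub topspace_Y by (auto simp: Y_def closure_of_subtopology Q_def inf.absorb2)
  moreover have "zero_dimensional_space Y"
    unfolding zero_dimensional_space_iff using K_base openin_K closedin_K by metis
  moreover have "locally_compact_space Y"
    unfolding locally_compact_space_def
    using K_base[OF openin_topspace] openin_K compactin_K by (metis order_refl)
  ultimately show ?thesis
    using embedding_e Hausdorff_Y by (simp add: zlc_extension_def extension_def)
qed

lemma ext_proximity_Y: "ext_proximity X (Y, e) = (\<delta>, \<B>)"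
proof -
  interpret E: zlc_ext X Y e by standard (rule zlc_extension_Y)
  have trK: "E.trace (K C) = C" if "C \<in> R" for C
    using that e_in_K R_subset by (auto simp: E.trace_def)
  have trK': "E.trace (topspace Y - K C) = topspace X - C" if "C \<in> R" for C
    using that e_in_K e_in_Y by (auto simp: E.trace_def)
  have clK: "E.cl C = K C" if "C \<in> R" for C
    using E.cl_trace_clopen[OF openin_K closedin_K, of C] trK that by simp
  have clK': "E.cl A \<inter> K C = {}" if "C \<in> R" "A \<subseteq> topspace X" "A \<inter> C = {}" for A C
  proof -
    have "E.cl A \<subseteq> E.cl (topspace X - C)" using that by (intro E.cl_mono) auto
    also have "\<dots> \<subseteq> topspace Y - K C"
      using E.cl_trace_closed[of "topspace Y - K C"] openin_K trK' that(1) by auto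
    finally show ?thesis by blast
  qed
  have between: "\<exists>C\<in>R. A \<subseteq> C \<and> K C \<subseteq> U"
    if A: "A \<in> E.\<B>" and U: "openin Y U" "E.cl A \<subseteq> U" for A U
  proof -
    have AX: "A \<subseteq> topspace X" and c: "compactin Y (E.cl A)" using A by (auto simp: E.\<B>_def)
    obtain V where V: "V \<in> K ` R" "E.cl A \<subseteq> V" "V \<subseteq> U"
    proof (rule compactin_base_between[OF c U(2), of "K ` R"])
      show "{} \<in> K ` R" using clK[OF R_empty] R_empty by (metis E.cl_empty image_eqI)
      show "V \<union> W \<in> K ` R" if "V \<in> K ` R" "W \<in> K ` R" for V W
        using that K_Un R_Un by (auto simp flip: K_Un)
      show "openin Y V" if "V \<in> K ` R" for V using that openin_K by blast
      show "\<exists>V\<in>K ` R. y \<in> V \<and> V \<subseteq> U" if "y \<in> E.cl A" for y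
      proof -
        have "y \<in> U" using that U(2) by blast
        then obtain C where "C \<in> R" "y \<in> K C" "K C \<subseteq> U" using K_base[OF U(1)] by metis
        then show ?thesis by blast
      qed
    qed
    then obtain C where "C \<in> R" "E.cl A \<subseteq> K C" "K C \<subseteq> U" by blast
    moreover from this have "A \<subseteq> C" using AX E.f_in_cl e_in_K by blast
    ultimately show ?thesis by blast
  qed
  have \<B>: "E.\<B> = \<B>"
  proof
    show "E.\<B> \<subseteq> \<B>"
      using between[OF _ openin_topspace E.cl_subset_topspace] R_bounded bounded_subset by blast
    show "\<B> \<subseteq> E.\<B>"
    proof
      fix A assume A: "A \<in> \<B>"
      then obtain C where C: "C \<in> R" "A \<subseteq> C" using bounded_in_R by blast
      then have "E.cl A \<subseteq> K C" using clK E.cl_mono by blast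
      then show "A \<in> E.\<B>"
        using closed_compactin[OF compactin_K _ E.closedin_cl] A bounded_subset_topspace
        by (auto simp: E.\<B>_def)
    qed
  qed
  have bdd: "(A, C) \<in> \<delta> \<longleftrightarrow> (A, C) \<in> E.\<delta>" if A: "A \<in> \<B>" and C: "C \<subseteq> topspace X" for A C
  proof -
    have AX: "A \<subseteq> topspace X" using A bounded_subset_topspace by blast
    have "E.cl A \<inter> E.cl C = {}" if n: "(A, C) \<notin> \<delta>"
    proof -
      obtain D where D: "D \<in> R" "A \<subseteq> D" "D \<inter> C = {}" using R_separates[OF A C n] .
      have "E.cl A \<subseteq> K D" using D clK E.cl_mono by blast
      moreover have "E.cl C \<inter> K D = {}" using clK' D C by blast
      ultimately show ?thesis by blast
    qed
    moreover have "(A, C) \<notin> \<delta>" if n: "E.cl A \<inter> E.cl C = {}"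
    proof -
      have "E.cl A \<subseteq> topspace Y - E.cl C" using n E.cl_subset_topspace by blast
      then obtain D where D: "D \<in> R" "A \<subseteq> D" "K D \<subseteq> topspace Y - E.cl C"
        using between[of A "topspace Y - E.cl C"] A \<B> E.closedin_cl by blast
      have "C \<inter> D = {}" using D C E.f_in_cl e_in_K by blast
      then show ?thesis using not_prox_R D C by blast
    qed
    ultimately show ?thesis using AX C by (auto simp: E.\<delta>_def)
  qed
  \<comment> \<open>This makes symmetry, monotonicity and (BC2) available for
    \<open>E.\<delta>\<close>, so both inclusions can pass to a bounded subset of
    \<open>A\<close>.\<close>
  interpret E': zero_dim_proximity X E.\<delta> E.\<B> by standard (rule E.ext_proximity_in_LP0)
  have "(A, C) \<in> \<delta> \<longleftrightarrow> (A, C) \<in> E.\<delta>" for A C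
  proof
    assume AC: "(A, C) \<in> \<delta>"
    then obtain B where B: "B \<in> \<B>" "B \<subseteq> A" "(C, B) \<in> \<delta>" using prox_bounded prox_sym by blast
    then have "(B, C) \<in> E.\<delta>" using bdd prox_sym prox_subset by blast
    then show "(A, C) \<in> E.\<delta>" using E'.prox_mono B(2) prox_subset[OF AC] by blast
  next
    assume AC: "(A, C) \<in> E.\<delta>"
    then obtain B where B: "B \<in> \<B>" "B \<subseteq> A" "(C, B) \<in> E.\<delta>"
      using E'.prox_bounded E'.prox_sym unfolding \<B> by blast
    then have "(B, C) \<in> \<delta>" using bdd E'.prox_sym E'.prox_subset by blast
    then show "(A, C) \<in> \<delta>" using prox_mono B(2) E'.prox_subset[OF AC] by blast
  qed
  then have "E.\<delta> = \<delta>" by auto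
  then show ?thesis using \<B> by (simp add: E.ext_proximity_eq)
qed

end

text \<open>The points of the constructed \<open>Y\<close> are functions, so the extension is moved
  to the point type of \<open>'a ext\<close>. Equivalent extensions lie below each other, so their
  proximities agree by antisymmetry.\<close>

lemma LP0_extension:
  assumes "p \<in> LP0 X"
  obtains E :: "'a ext" where "zlc_extension X E" "ext_proximity X E = p"
proof -
  interpret zero_dim_proximity X "fst p" "snd p" by standard (simp add: assms)
  obtain E :: "'a ext" where E: "zlc_extension X E" "ext_equiv X (Y, e) E"
    using zlc_extension_small[OF zlc_extension_Y] .
  obtain Z g where Z: "E = (Z, g)" by fastforce
  have "ext_equiv X E (Y, e)"
    using ext_equiv_sym[OF _ E(2)] zlc_extension_Y by (simp add: zlc_extension_def)
  then have "LP0_le (ext_proximity X E) (ext_proximity X (Y, e))"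
      "LP0_le (ext_proximity X (Y, e)) (ext_proximity X E)"
    using ext_equiv_imp_le E zlc_extension_Y
    by (auto simp: Z intro!: ext_le_imp_LP0_le)
  then have "ext_proximity X E = p"
    using LP0_le_antisym ext_proximity_Y by (metis prod.collapse)
  then show thesis using that E(1) by blast
qed

subsection \<open>The isomorphism\<close>

theorem theorem3p2:
  fixes X :: "'a topology"
  assumes "zero_dimensional_space X" and "Hausdorff_space X"
  shows "order_isomorphic (L0 X) (L0_le X) (LP0 X) LP0_le"
proof -
  let ?P = "ext_proximity X :: 'a ext \<Rightarrow> _"
  let ?cls = "\<lambda>E :: 'a ext. ext_rel X `` {E}"
  have le: "ext_le X E1 E2 \<longleftrightarrow> LP0_le (?P E1) (?P E2)"
    if "zlc_extension X E1" "zlc_extension X E2" for E1 E2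
    using that ext_le_iff by (metis surj_pair)
  have eqP: "?P E1 = ?P E2" if "(E1, E2) \<in> ext_rel X" for E1 E2
  proof -
    have E: "zlc_extension X E1" "zlc_extension X E2" "ext_equiv X E1 E2"
      using that by (auto simp: ext_rel_def)
    then have "ext_equiv X E2 E1" by (auto simp: zlc_extension_def intro: ext_equiv_sym)
    then have "LP0_le (?P E1) (?P E2)" "LP0_le (?P E2) (?P E1)"
      using E le ext_equiv_imp_le by blast+
    then show ?thesis by (rule LP0_le_antisym)
  qed
  \<comment> \<open>By \<open>eqP\<close> the value does not depend on the chosen
    representative.\<close>
  define \<Phi> where "\<Phi> c = ?P (SOME E. E \<in> c)" for c
  have \<Phi>: "\<Phi> (?cls E) = ?P E" if "zlc_extension X E" for E
  proof -
    have "E \<in> ?cls E" using that by (simp add: ext_rel_def ext_equiv_refl)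
    then have "(SOME E'. E' \<in> ?cls E) \<in> ?cls E" by (rule someI)
    then have "(E, SOME E'. E' \<in> ?cls E) \<in> ext_rel X" by simp
    from eqP[OF this] show ?thesis by (simp add: \<Phi>_def)
  qed
  have cls: "\<exists>E. zlc_extension X E \<and> c = ?cls E" if "c \<in> L0 X" for c
    using that by (auto simp: L0_def elim!: quotientE)
  have cls': "?cls E \<in> L0 X" if "zlc_extension X E" for E
    using that by (auto simp: L0_def intro!: quotientI)
  have ord: "L0_le X c d \<longleftrightarrow> LP0_le (\<Phi> c) (\<Phi> d)" if cd: "c \<in> L0 X" "d \<in> L0 X" for c d
  proof -
    obtain E1 E2 where E: "zlc_extension X E1" "c = ?cls E1" "zlc_extension X E2" "d = ?cls E2"
      using cls cd by metis
    then show ?thesis using L0_le_class[OF E(1,3)] le[OF E(1,3)] \<Phi> by metis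
  qed
  have "inj_on \<Phi> (L0 X)"
  proof (rule inj_onI)
    fix c d assume cd: "c \<in> L0 X" "d \<in> L0 X" "\<Phi> c = \<Phi> d"
    obtain E1 E2 where E: "zlc_extension X E1" "c = ?cls E1" "zlc_extension X E2" "d = ?cls E2"
      using cls cd by metis
    have P: "?P E1 = ?P E2" using cd(3) \<Phi> E by metis
    \<comment> \<open>Equal proximities are comparable both ways, so reflecting the order gives maps
      in both directions, and antisymmetry turns these into an equivalence.\<close>
    have "LP0_le (?P E1) (?P E1)" by (simp add: LP0_le_def split: prod.split)
    then have "ext_le X E1 E2" "ext_le X E2 E1" using le E P by metis+
    then have "ext_equiv X E1 E2" using ext_le_antisym E by metis
    then have "(E1, E2) \<in> ext_rel X" using E by (simp add: ext_rel_def)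
    then show "c = d" using equiv_class_eq[OF equiv_ext_rel] E by metis
  qed
  moreover have "\<Phi> ` L0 X = LP0 X"
  proof (intro equalityI subsetI)
    fix p assume "p \<in> \<Phi> ` L0 X"
    then obtain c where c: "c \<in> L0 X" "p = \<Phi> c" by blast
    obtain E where E: "zlc_extension X E" "c = ?cls E" using cls c(1) by metis
    then show "p \<in> LP0 X" using \<Phi>[OF E(1)] ext_proximity_LP0[OF E(1)] c(2) by simp
  next
    fix p assume "p \<in> LP0 X"
    then obtain E :: "'a ext" where E: "zlc_extension X E" "?P E = p"
      using LP0_extension by metis
    then show "p \<in> \<Phi> ` L0 X" using \<Phi>[OF E(1)] cls'[OF E(1)] by (metis image_eqI)
  qed
  ultimately have "bij_betw \<Phi> (L0 X) (LP0 X)" by (simp add: bij_betw_def)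
  then show ?thesis unfolding order_isomorphic_def using ord by blast
qed

end
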